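(* The Riemannian submersion defined by the projection of the warped product $$\pi:\left(\mathbb{R}^2\times\mathbb{R},\;dx^2+dy^2+\beta^{-2}(x,y)\,dz^2\right)\to\left(\mathbb{R}^2,\;dx^2+dy^2\right),\qquad \pi(x,y,z)=(x,y),$$ is a generalized harmonic morphism if and only if $$\beta(x,y)=C(x+C_1y+C_2)^{-2}\quad\text{or}\quad\beta(x,y)=C(C_1x+y+C_2)^{-2}$$ for any constants $C>0$, $C_1$, $C_2$.
   Context: A map $\phi:(M^m,g)\to(N^n,h)$ between Riemannian manifolds is called a generalized harmonic morphism if for any harmonic function $f:U\to\mathbb{R}$ on an open set $U\subseteq N$ with $V=\phi^{-1}(U)$ non-empty, the function $f\circ\phi:V\to\mathbb{R}$ is biharmonic on $V\subseteq M$. Here a function $u$ on a Riemannian manifold is harmonic if $\Delta u=0$ and biharmonic if $\Delta(\Delta u)=0$, with $\Delta$ the Laplace–Beltrami operator. The function $\beta=\beta(x,y)$ is the function of $(x,y)$ that determines the warped product metric $dx^2+dy^2+\beta^{-2}(x,y)\,dz^2$.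
   Formalization: β is assumed nonconstant: for constant β the projection is a generalized harmonic morphism but neither formula holds. Since the formulas are singular on a line, ℝ² is replaced by any open connected D ⊆ ℝ² (projection D×ℝ → D), with β smooth and positive on D. *)

theory Defs
  imports "HOL-Analysis.Analysis"
begin

definition partial_deriv :: "'n::finite \<Rightarrow> (real ^ 'n \<Rightarrow> real) \<Rightarrow> real ^ 'n \<Rightarrow> real" where
  "partial_deriv i f x = frechet_derivative f (at x) (axis i 1)"

text \<open>\<open>C\<^sup>\<infinity>\<close>: every iterated partial derivative exists and is (totally) differentiable, hence
  continuous.\<close>

definition smooth_on :: "(real ^ 'n::finite) set \<Rightarrow> (real ^ 'n \<Rightarrow> real) \<Rightarrow> bool" where
  "smooth_on S f \<longleftrightarrow> (\<forall>is. \<forall>x\<in>S. foldr partial_deriv is f differentiable (at x))"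

text \<open>A Riemannian manifold is represented here by an open set of \<open>\<real>\<^sup>n\<close> (a global chart) together with
  the field \<open>g\<close> of Gram matrices \<open>g\<^sub>i\<^sub>j\<close> of its metric.  The Laplace--Beltrami operator is
  \<open>\<Delta> u = (det g)\<^sup>-\<^sup>1\<^sup>/\<^sup>2 \<Sum>\<^sub>i \<partial>\<^sub>i ((det g)\<^sup>1\<^sup>/\<^sup>2 \<Sum>\<^sub>j g\<^sup>i\<^sup>j \<partial>\<^sub>j u)\<close>.\<close>

definition laplace_beltrami ::
    "(real ^ 'n::finite \<Rightarrow> real ^ 'n ^ 'n) \<Rightarrow> (real ^ 'n \<Rightarrow> real) \<Rightarrow> real ^ 'n \<Rightarrow> real" where
  "laplace_beltrami g u x =
     (\<Sum>i\<in>UNIV. partial_deriv i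
        (\<lambda>y. sqrt (det (g y)) * (\<Sum>j\<in>UNIV. matrix_inv (g y) $ i $ j * partial_deriv j u y)) x)
     / sqrt (det (g x))"

definition harmonic_on ::
    "(real ^ 'n::finite \<Rightarrow> real ^ 'n ^ 'n) \<Rightarrow> (real ^ 'n) set \<Rightarrow> (real ^ 'n \<Rightarrow> real) \<Rightarrow> bool" where
  "harmonic_on g U u \<longleftrightarrow> smooth_on U u \<and> (\<forall>x\<in>U. laplace_beltrami g u x = 0)"

definition biharmonic_on ::
    "(real ^ 'n::finite \<Rightarrow> real ^ 'n ^ 'n) \<Rightarrow> (real ^ 'n) set \<Rightarrow> (real ^ 'n \<Rightarrow> real) \<Rightarrow> bool" where
  "biharmonic_on g U u \<longleftrightarrow>
     smooth_on U u \<and> (\<forall>x\<in>U. laplace_beltrami g (laplace_beltrami g u) x = 0)"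

text \<open>Maps between manifolds are understood to be smooth.\<close>

definition generalized_harmonic_morphism ::
    "(real ^ 'm::finite) set \<Rightarrow> (real ^ 'm \<Rightarrow> real ^ 'm ^ 'm) \<Rightarrow>
     (real ^ 'n::finite) set \<Rightarrow> (real ^ 'n \<Rightarrow> real ^ 'n ^ 'n) \<Rightarrow>
     (real ^ 'm \<Rightarrow> real ^ 'n) \<Rightarrow> bool" where
  "generalized_harmonic_morphism M g N h \<phi> \<longleftrightarrow>
     \<phi> ` M \<subseteq> N \<and> (\<forall>i. smooth_on M (\<lambda>p. \<phi> p $ i)) \<and>
     (\<forall>U f. open U \<and> U \<subseteq> N \<and> M \<inter> \<phi> -` U \<noteq> {} \<and> harmonic_on h U f
        \<longrightarrow> biharmonic_on g (M \<inter> \<phi> -` U) (f \<circ> \<phi>))"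

definition proj_xy :: "real ^ 3 \<Rightarrow> real ^ 2" where
  "proj_xy p = vector [p $ 1, p $ 2]"

text \<open>\<open>D \<times> \<real>\<close> as a subset of \<open>\<real>\<^sup>3\<close>.\<close>

definition cylinder :: "(real ^ 2) set \<Rightarrow> (real ^ 3) set" where
  "cylinder D = {p. proj_xy p \<in> D}"

text \<open>The metric \<open>dx\<^sup>2 + dy\<^sup>2 + \<beta>\<^sup>-\<^sup>2(x,y) dz\<^sup>2\<close>.\<close>

definition warped_metric :: "(real ^ 2 \<Rightarrow> real) \<Rightarrow> real ^ 3 \<Rightarrow> real ^ 3 ^ 3" where
  "warped_metric \<beta> p = vector [vector [1, 0, 0],
                               vector [0, 1, 0],
                               vector [0, 0, \<beta> (proj_xy p) powi (-2)]]"

definition flat_metric :: "real ^ 2 \<Rightarrow> real ^ 2 ^ 2" where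
  "flat_metric p = mat 1"

end

theory Submission
  imports Defs
begin

text \<open>
  Write \<open>\<beta> = \<psi>\<^sup>-\<^sup>2\<close>.  The volume density of the warped metric is then \<open>\<psi>\<^sup>2\<close>, so on functions pulled
  back from the plane the Laplace--Beltrami operator becomes the drift Laplacian
  \<open>E u = \<Delta>u + 2 \<langle>\<nabla>\<psi>, \<nabla>u\<rangle> / \<psi>\<close> (\<open>laplace_beltrami_pullback\<close>).  The substitution pays off through the
  identity \<open>\<psi> E u = \<Delta>(\<psi> u) - u \<Delta>\<psi>\<close> (\<open>weighted_laplacian_conjugate\<close>): for harmonic \<open>f\<close> one has
  \<open>\<psi> E f = 2 v\<close> with \<open>v = \<langle>\<nabla>\<psi>, \<nabla>f\<rangle>\<close>, hence \<open>\<psi>\<^sup>2 E (E f) = 2 (\<psi> \<Delta>v - v \<Delta>\<psi>)\<close>.  The pullback of \<open>f\<close> is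
  therefore biharmonic exactly when \<open>\<psi> \<Delta>v = v \<Delta>\<psi>\<close> (\<open>biharmonic_pullback_iff\<close>).

  For nonconstant \<open>\<beta>\<close>, the statement thus says that \<open>\<psi> \<Delta>\<langle>\<nabla>\<psi>, \<nabla>f\<rangle> = \<langle>\<nabla>\<psi>, \<nabla>f\<rangle> \<Delta>\<psi>\<close> holds for
  all local harmonic \<open>f\<close> if and only if \<open>\<psi>\<close> is affine.  If \<open>\<psi>\<close> is affine, \<open>\<langle>\<nabla>\<psi>, \<nabla>f\<rangle>\<close> is a constant-coefficient combination of
  derivatives of \<open>f\<close>, so it is harmonic and both sides vanish.  Conversely, the functions \<open>x\<close> and
  \<open>y\<close> give \<open>\<psi> \<Delta>\<nabla>\<psi> = \<Delta>\<psi> \<nabla>\<psi>\<close>; given this, only the term \<open>2 \<psi> \<langle>Hess \<psi>, Hess f\<rangle>\<close> survives, and the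
  functions \<open>xy\<close> and \<open>x\<^sup>2 - y\<^sup>2\<close> force the Hessian of \<open>\<psi>\<close> to be a multiple \<open>K\<close> of the identity.
  Comparing third derivatives, \<open>K\<close> is constant, so \<open>\<Delta>\<nabla>\<psi> = 0\<close> and the first relation reads
  \<open>K \<nabla>\<psi> = 0\<close>.  As \<open>\<beta>\<close> is not constant, \<open>K = 0\<close> and \<open>\<psi>\<close> is affine
  (\<open>affine_if_biharmonic_condition\<close>).

  The two forms of \<open>\<beta>\<close> in the theorem are the ways to normalise the coefficient of \<open>x\<close> or of \<open>y\<close> in
  a nonconstant affine function to \<open>1\<close>.
\<close>

section \<open>Partial derivatives\<close>

lemma partial_deriv_eq: "(f has_derivative f') (at x) \<Longrightarrow> partial_deriv i f x = f' (axis i 1)"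
  unfolding partial_deriv_def by (metis frechet_derivative_at)

text \<open>Partial derivatives depend only on germs.  This is what allows identities known merely on an
  open set to be differentiated.\<close>
lemma partial_deriv_cong:
  assumes "open S" "x \<in> S" "\<And>y. y \<in> S \<Longrightarrow> f y = g y"
  shows "partial_deriv i f x = partial_deriv i g x"
proof -
  have "(f has_derivative d) (at x) \<longleftrightarrow> (g has_derivative d) (at x)" for d
    using assms has_derivative_transform_within_open by metis
  then show ?thesis
    unfolding partial_deriv_def frechet_derivative_def by simp
qed

lemma differentiable_cong:
  assumes "open S" "x \<in> S" "\<And>y. y \<in> S \<Longrightarrow> f y = g y" "g differentiable (at x)"
  shows "f differentiable (at x)"
  using assms unfolding differentiable_def by (metis has_derivative_transform_within_open)

lemma
  assumes "f differentiable (at x)" "g differentiable (at x)"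
  shows partial_deriv_add:
      "partial_deriv i (\<lambda>y. f y + g y) x = partial_deriv i f x + partial_deriv i g x"
    and partial_deriv_diff:
      "partial_deriv i (\<lambda>y. f y - g y) x = partial_deriv i f x - partial_deriv i g x"
    and partial_deriv_mult:
      "partial_deriv i (\<lambda>y. f y * g y) x = f x * partial_deriv i g x + partial_deriv i f x * g x"
proof -
  note d = assms[unfolded frechet_derivative_works]
  show "partial_deriv i (\<lambda>y. f y + g y) x = partial_deriv i f x + partial_deriv i g x"
    using partial_deriv_eq[OF has_derivative_add[OF d]] by (simp add: partial_deriv_def)
  show "partial_deriv i (\<lambda>y. f y - g y) x = partial_deriv i f x - partial_deriv i g x"
    using partial_deriv_eq[OF has_derivative_diff[OF d]] by (simp add: partial_deriv_def)
  show "partial_deriv i (\<lambda>y. f y * g y) x = f x * partial_deriv i g x + partial_deriv i f x * g x"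
    using partial_deriv_eq[OF has_derivative_mult[OF d]] by (simp add: partial_deriv_def)
qed

lemma partial_deriv_const [simp]: "partial_deriv i (\<lambda>y. c) = (\<lambda>x. 0)"
  by (rule ext, rule partial_deriv_eq[OF has_derivative_const])

lemma has_derivative_component: "((\<lambda>y. y $ k) has_derivative (\<lambda>y. y $ k)) (at (x :: real ^ 'n))"
  by (rule bounded_linear_imp_has_derivative[OF bounded_linear_vec_nth])

lemma partial_deriv_component [simp]: "partial_deriv i (\<lambda>y. y $ k) = (\<lambda>x. if i = k then 1 else 0)"
  by (rule ext, subst partial_deriv_eq[OF has_derivative_component]) (auto simp: axis_def)

lemma differentiable_component: "(\<lambda>y. y $ k) differentiable (at (x :: real ^ 'n))"
  using has_derivative_component unfolding differentiable_def by blast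

lemma partial_deriv_cmult_component:
  "partial_deriv i (\<lambda>y. c * y $ k) = (\<lambda>x. if i = k then c else 0)"
  by (simp add: fun_eq_iff partial_deriv_mult differentiable_component)

lemma has_derivative_real_comp:
  fixes h :: "real \<Rightarrow> real"
  assumes "f differentiable (at x)" "(h has_real_derivative h') (at (f x))"
  shows "((\<lambda>y. h (f y)) has_derivative (\<lambda>v. h' * frechet_derivative f (at x) v)) (at x)"
  using has_derivative_compose[OF assms(1)[unfolded frechet_derivative_works]
      assms(2)[unfolded has_field_derivative_def]] by simp

section \<open>Calculus of smooth functions\<close>

text \<open>A class of functions is smooth as soon as its members are differentiable and, on \<open>S\<close>, their
  partial derivatives agree with members of the class: by induction every iterated derivative
  agrees with a member.  Agreement on \<open>S\<close> only is essential, since derivative rules for products or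
  powers say nothing outside \<open>S\<close>.\<close>
lemma smooth_on_coinduct:
  assumes "open S" "P f"
    and step: "\<And>f. P f \<Longrightarrow> (\<forall>x\<in>S. f differentiable (at x)) \<and>
      (\<forall>i. \<exists>g. P g \<and> (\<forall>x\<in>S. partial_deriv i f x = g x))"
  shows "smooth_on S f"
proof -
  have "\<exists>g. P g \<and> (\<forall>x\<in>S. foldr partial_deriv is f x = g x)" for "is"
  proof (induction "is")
    case Nil
    then show ?case using assms(2) by auto
  next
    case (Cons i "is")
    then obtain g where g: "P g" "\<forall>x\<in>S. foldr partial_deriv is f x = g x" by blast
    have "partial_deriv i (foldr partial_deriv is f) x = partial_deriv i g x" if "x \<in> S" for x
      using partial_deriv_cong[OF assms(1) that] g(2) by blast
    with step[OF g(1)] show ?case by fastforce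
  qed
  then show ?thesis
    unfolding smooth_on_def using step differentiable_cong[OF assms(1)] by metis
qed

lemma smooth_on_differentiable: "smooth_on S f \<Longrightarrow> x \<in> S \<Longrightarrow> f differentiable (at x)"
  unfolding smooth_on_def by (metis foldr.simps(1) id_apply)

lemma smooth_on_partial_deriv: "smooth_on S f \<Longrightarrow> smooth_on S (partial_deriv i f)"
  unfolding smooth_on_def
proof (intro allI ballI)
  fix "is" x
  assume "\<forall>is. \<forall>x\<in>S. foldr partial_deriv is f differentiable at x" "x \<in> S"
  then have "foldr partial_deriv (is @ [i]) f differentiable at x" by blast
  then show "foldr partial_deriv is (partial_deriv i f) differentiable at x" by simp
qed

text \<open>A product of smooth functions has a sum of products as its derivative, so closure under products
  alone is not an invariant for the coinduction.  The class generated by all the operations of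
  interest is one, and it yields all closure rules at once.\<close>
inductive smooth_expr :: "(real ^ 'n::finite) set \<Rightarrow> (real ^ 'n \<Rightarrow> real) \<Rightarrow> bool" for S where
  base: "smooth_on S f \<Longrightarrow> smooth_expr S f"
| const: "smooth_expr S (\<lambda>x. c)"
| component: "smooth_expr S (\<lambda>x. x $ k)"
| add: "smooth_expr S f \<Longrightarrow> smooth_expr S g \<Longrightarrow> smooth_expr S (\<lambda>x. f x + g x)"
| mult: "smooth_expr S f \<Longrightarrow> smooth_expr S g \<Longrightarrow> smooth_expr S (\<lambda>x. f x * g x)"
| inverse: "smooth_expr S f \<Longrightarrow> (\<And>x. x \<in> S \<Longrightarrow> f x \<noteq> 0) \<Longrightarrow> smooth_expr S (\<lambda>x. inverse (f x))"
| powr: "smooth_expr S f \<Longrightarrow> (\<And>x. x \<in> S \<Longrightarrow> f x > 0) \<Longrightarrow> smooth_expr S (\<lambda>x. f x powr c)"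

lemma smooth_expr_partial_deriv:
  "smooth_expr S f \<Longrightarrow> (\<forall>x\<in>S. f differentiable (at x)) \<and>
      (\<forall>i. \<exists>g. smooth_expr S g \<and> (\<forall>x\<in>S. partial_deriv i f x = g x))"
proof (induction rule: smooth_expr.induct)
  case (base f)
  then show ?case
    using smooth_on_differentiable smooth_on_partial_deriv smooth_expr.base by metis
next
  case (const c)
  then show ?case using smooth_expr.const by (auto intro!: exI[of _ "\<lambda>_. 0"])
next
  case (component k)
  have "smooth_expr S (\<lambda>x. if i = k then 1 else 0)" for i
    by (rule smooth_expr.const)
  then show ?case using has_derivative_component
    unfolding partial_deriv_component differentiable_def by blast
next
  case (add f g)
  show ?case
  proof (intro conjI allI ballI)
    fix x assume "x \<in> S"
    then show "(\<lambda>x. f x + g x) differentiable at x" using add by (intro differentiable_add) auto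
  next
    fix i
    obtain f' g' where "smooth_expr S f'" "\<forall>x\<in>S. partial_deriv i f x = f' x"
      "smooth_expr S g'" "\<forall>x\<in>S. partial_deriv i g x = g' x" using add by meson
    then show "\<exists>h. smooth_expr S h \<and> (\<forall>x\<in>S. partial_deriv i (\<lambda>x. f x + g x) x = h x)"
      using add
      by (intro exI[of _ "\<lambda>x. f' x + g' x"]) (auto simp: partial_deriv_add intro: smooth_expr.add)
  qed
next
  case (mult f g)
  show ?case
  proof (intro conjI allI ballI)
    fix x assume "x \<in> S"
    then show "(\<lambda>x. f x * g x) differentiable at x" using mult by (intro differentiable_mult) auto
  next
    fix i
    obtain f' g' where "smooth_expr S f'" "\<forall>x\<in>S. partial_deriv i f x = f' x"
      "smooth_expr S g'" "\<forall>x\<in>S. partial_deriv i g x = g' x" using mult by meson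
    then show "\<exists>h. smooth_expr S h \<and> (\<forall>x\<in>S. partial_deriv i (\<lambda>x. f x * g x) x = h x)"
      using mult
      by (intro exI[of _ "\<lambda>x. f x * g' x + f' x * g x"])
        (auto simp: partial_deriv_mult intro: smooth_expr.add smooth_expr.mult)
  qed
next
  case (inverse f)
  have d: "((\<lambda>y. inverse (f y)) has_derivative
      (\<lambda>v. - (inverse (f x) * inverse (f x)) * frechet_derivative f (at x) v)) (at x)"
    if "x \<in> S" for x
    using that inverse
    by (intro has_derivative_real_comp) (auto intro!: derivative_eq_intros simp: field_simps)
  show ?case
  proof (intro conjI allI ballI)
    fix x assume "x \<in> S"
    then show "(\<lambda>x. inverse (f x)) differentiable at x" using d unfolding differentiable_def by blast
  next
    fix i
    obtain f' where f': "smooth_expr S f'" "\<forall>x\<in>S. partial_deriv i f x = f' x"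
      using inverse by meson
    have "smooth_expr S (\<lambda>x. -1 * (inverse (f x) * inverse (f x)) * f' x)"
      by (intro smooth_expr.intros inverse.hyps f')
    moreover have "\<forall>x\<in>S. partial_deriv i (\<lambda>x. inverse (f x)) x
        = -1 * (inverse (f x) * inverse (f x)) * f' x"
      using partial_deriv_eq[OF d] f'(2) by (auto simp: partial_deriv_def)
    ultimately show "\<exists>h. smooth_expr S h \<and> (\<forall>x\<in>S. partial_deriv i (\<lambda>x. inverse (f x)) x = h x)"
      by blast
  qed
next
  case (powr f c)
  have d: "((\<lambda>y. f y powr c) has_derivative
      (\<lambda>v. (c * f x powr (c - 1)) * frechet_derivative f (at x) v)) (at x)"
    if "x \<in> S" for x
    using that powr by (intro has_derivative_real_comp has_real_derivative_powr) auto
  show ?case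
  proof (intro conjI allI ballI)
    fix x assume "x \<in> S"
    then show "(\<lambda>x. f x powr c) differentiable at x" using d unfolding differentiable_def by blast
  next
    fix i
    obtain f' where f': "smooth_expr S f'" "\<forall>x\<in>S. partial_deriv i f x = f' x"
      using powr by meson
    have "smooth_expr S (\<lambda>x. c * f x powr (c - 1) * f' x)"
      by (intro smooth_expr.intros powr.hyps f')
    moreover have "\<forall>x\<in>S. partial_deriv i (\<lambda>x. f x powr c) x = c * f x powr (c - 1) * f' x"
      using partial_deriv_eq[OF d] f'(2) by (auto simp: partial_deriv_def)
    ultimately show "\<exists>h. smooth_expr S h \<and> (\<forall>x\<in>S. partial_deriv i (\<lambda>x. f x powr c) x = h x)"
      by blast
  qed
qed

lemma smooth_on_if_smooth_expr: "open S \<Longrightarrow> smooth_expr S f \<Longrightarrow> smooth_on S f"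
  by (rule smooth_on_coinduct[of S "smooth_expr S"]) (auto dest: smooth_expr_partial_deriv)

lemma smooth_on_const: "open S \<Longrightarrow> smooth_on S (\<lambda>x. c)"
  by (rule smooth_on_if_smooth_expr, assumption, rule smooth_expr.const)

lemma smooth_on_component: "open S \<Longrightarrow> smooth_on S (\<lambda>x. x $ k)"
  by (rule smooth_on_if_smooth_expr, assumption, rule smooth_expr.component)

lemma smooth_on_add:
  "open S \<Longrightarrow> smooth_on S f \<Longrightarrow> smooth_on S g \<Longrightarrow> smooth_on S (\<lambda>x. f x + g x)"
  by (rule smooth_on_if_smooth_expr, assumption, intro smooth_expr.add smooth_expr.base)

lemma smooth_on_mult:
  "open S \<Longrightarrow> smooth_on S f \<Longrightarrow> smooth_on S g \<Longrightarrow> smooth_on S (\<lambda>x. f x * g x)"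
  by (rule smooth_on_if_smooth_expr, assumption, intro smooth_expr.mult smooth_expr.base)

lemma smooth_on_diff:
  "open S \<Longrightarrow> smooth_on S f \<Longrightarrow> smooth_on S g \<Longrightarrow> smooth_on S (\<lambda>x. f x - g x)"
  using smooth_on_add[of S f "\<lambda>x. -1 * g x"] smooth_on_mult[OF _ smooth_on_const[of S "-1"], of g]
  by simp

lemma smooth_on_inverse:
  "open S \<Longrightarrow> smooth_on S f \<Longrightarrow> (\<And>x. x \<in> S \<Longrightarrow> f x \<noteq> 0) \<Longrightarrow> smooth_on S (\<lambda>x. inverse (f x))"
  by (rule smooth_on_if_smooth_expr, assumption, rule smooth_expr.inverse, rule smooth_expr.base)

lemma smooth_on_powr:
  "open S \<Longrightarrow> smooth_on S f \<Longrightarrow> (\<And>x. x \<in> S \<Longrightarrow> f x > 0) \<Longrightarrow> smooth_on S (\<lambda>x. f x powr c)"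
  by (rule smooth_on_if_smooth_expr, assumption, rule smooth_expr.powr, rule smooth_expr.base)

lemmas smooth_on_intros = smooth_on_const smooth_on_component smooth_on_add smooth_on_diff
  smooth_on_mult smooth_on_inverse smooth_on_powr smooth_on_partial_deriv

lemma smooth_partial_deriv_add:
  "smooth_on S f \<Longrightarrow> smooth_on S g \<Longrightarrow> x \<in> S \<Longrightarrow>
    partial_deriv i (\<lambda>y. f y + g y) x = partial_deriv i f x + partial_deriv i g x"
  and smooth_partial_deriv_mult:
  "smooth_on S f \<Longrightarrow> smooth_on S g \<Longrightarrow> x \<in> S \<Longrightarrow>
    partial_deriv i (\<lambda>y. f y * g y) x = f x * partial_deriv i g x + partial_deriv i f x * g x"
  by (simp_all add: partial_deriv_add partial_deriv_mult smooth_on_differentiable)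

lemma second_partial_deriv_add:
  assumes S: "open S" and sm: "smooth_on S f" "smooth_on S g" and x: "x \<in> S"
  shows "partial_deriv i (partial_deriv j (\<lambda>y. f y + g y)) x
    = partial_deriv i (partial_deriv j f) x + partial_deriv i (partial_deriv j g) x"
  using partial_deriv_cong[OF S x smooth_partial_deriv_add[OF sm]]
    smooth_partial_deriv_add[OF smooth_on_partial_deriv[OF sm(1)] smooth_on_partial_deriv[OF sm(2)] x]
  by simp

lemma second_partial_deriv_mult:
  assumes S: "open S" and sm: "smooth_on S f" "smooth_on S g" and x: "x \<in> S"
  shows "partial_deriv i (partial_deriv j (\<lambda>y. f y * g y)) x
    = f x * partial_deriv i (partial_deriv j g) x + partial_deriv i f x * partial_deriv j g x
      + partial_deriv j f x * partial_deriv i g x + partial_deriv i (partial_deriv j f) x * g x"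
proof -
  have "partial_deriv i (partial_deriv j (\<lambda>y. f y * g y)) x
    = partial_deriv i (\<lambda>y. f y * partial_deriv j g y + partial_deriv j f y * g y) x"
    by (rule partial_deriv_cong[OF S x smooth_partial_deriv_mult[OF sm]])
  also have "\<dots> = partial_deriv i (\<lambda>y. f y * partial_deriv j g y) x + partial_deriv i (\<lambda>y. partial_deriv j f y * g y) x"
    by (rule smooth_partial_deriv_add[OF _ _ x]; intro smooth_on_intros S sm)
  finally show ?thesis
    using smooth_partial_deriv_mult[OF sm(1) smooth_on_partial_deriv[OF sm(2)] x, of i j]
      smooth_partial_deriv_mult[OF smooth_on_partial_deriv[OF sm(1)] sm(2) x, of i j] by simp
qed

section \<open>Symmetry of second derivatives\<close>

text \<open>Two applications of the mean value theorem, first in direction \<open>i\<close> and then in direction \<open>j\<close>.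
  The second difference on the left is symmetric in \<open>i\<close> and \<open>j\<close>, the right-hand side is not: this is
  the source of the symmetry of mixed derivatives.\<close>
lemma second_difference_eq_mixed_deriv:
  assumes "open S" "x \<in> S" and sm: "smooth_on S f"
  shows "\<exists>\<delta>>0. \<forall>t. 0 < t \<and> t < \<delta> \<longrightarrow> (\<exists>s r. 0 < s \<and> s < t \<and> 0 < r \<and> r < t \<and>
    f (x + t *\<^sub>R axis i 1 + t *\<^sub>R axis j 1) - f (x + t *\<^sub>R axis i 1) - f (x + t *\<^sub>R axis j 1) + f x
    = t * t * partial_deriv j (partial_deriv i f) (x + s *\<^sub>R axis i 1 + r *\<^sub>R axis j 1))"
proof -
  obtain e where e: "e > 0" "ball x e \<subseteq> S" using assms openE by blast
  have inS: "x + s *\<^sub>R axis i 1 + r *\<^sub>R axis j 1 \<in> S" if "0 \<le> s" "s < e/2" "0 \<le> r" "r < e/2" for s r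
  proof -
    have "norm (s *\<^sub>R axis i 1 + r *\<^sub>R axis j (1::real)) \<le> s + r"
      using norm_triangle_ineq[of "s *\<^sub>R axis i 1" "r *\<^sub>R axis j (1::real)"] that by simp
    then show ?thesis using e that by (auto simp: dist_norm subset_iff algebra_simps norm_minus_commute)
  qed
  have line: "((\<lambda>s. g (a + s *\<^sub>R axis k 1)) has_real_derivative partial_deriv k g (a + s *\<^sub>R axis k 1)) (at s)"
    if "g differentiable (at (a + s *\<^sub>R axis k 1))" for g :: "real ^ 'n \<Rightarrow> real" and a k s
  proof -
    have "((\<lambda>s. a + s *\<^sub>R axis k 1) has_derivative (\<lambda>h. h *\<^sub>R axis k 1)) (at s)"
      by (auto intro!: derivative_eq_intros)
    from has_derivative_compose[OF this that[unfolded frechet_derivative_works]]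
    have "((\<lambda>s. g (a + s *\<^sub>R axis k 1)) has_derivative
      (\<lambda>h. frechet_derivative g (at (a + s *\<^sub>R axis k 1)) (h *\<^sub>R axis k 1))) (at s)" .
    moreover have "frechet_derivative g (at (a + s *\<^sub>R axis k 1)) (h *\<^sub>R axis k 1)
        = partial_deriv k g (a + s *\<^sub>R axis k 1) * h" for h
      by (simp add: partial_deriv_def mult.commute linear_scale[OF linear_frechet_derivative[OF that]])
    ultimately show ?thesis by (simp add: has_field_derivative_def)
  qed
  have "\<exists>s r. 0 < s \<and> s < t \<and> 0 < r \<and> r < t \<and>
    f (x + t *\<^sub>R axis i 1 + t *\<^sub>R axis j 1) - f (x + t *\<^sub>R axis i 1) - f (x + t *\<^sub>R axis j 1) + f x
    = t * t * partial_deriv j (partial_deriv i f) (x + s *\<^sub>R axis i 1 + r *\<^sub>R axis j 1)"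
    if t: "0 < t" "t < e/2" for t
  proof -
    let ?p = "\<lambda>s r. x + s *\<^sub>R axis i 1 + r *\<^sub>R axis j 1"
    have d1: "((\<lambda>s. f (?p s r)) has_real_derivative partial_deriv i f (?p s r)) (at s)"
      if "0 \<le> s" "s \<le> t" "0 \<le> r" "r \<le> t" for s r
    proof -
      have swap: "x + r *\<^sub>R axis j 1 + s *\<^sub>R axis i 1 = ?p s r" for s by simp
      have "f differentiable (at (?p s r))"
        using smooth_on_differentiable[OF sm inS] that t by simp
      then show ?thesis using line[of f "x + r *\<^sub>R axis j 1" s i] unfolding swap by blast
    qed
    have d1': "((\<lambda>s. f (?p s t) - f (?p s 0)) has_real_derivative
        partial_deriv i f (?p s t) - partial_deriv i f (?p s 0)) (at s)"
      if "0 \<le> s" "s \<le> t" for s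
      by (rule DERIV_diff; rule d1) (use that t in auto)
    obtain s where s: "0 < s" "s < t"
      and s_eq: "(f (?p t t) - f (?p t 0)) - (f (?p 0 t) - f (?p 0 0))
        = (t - 0) * (partial_deriv i f (?p s t) - partial_deriv i f (?p s 0))"
      using MVT2[of 0 t "\<lambda>s. f (?p s t) - f (?p s 0)"
          "\<lambda>s. partial_deriv i f (?p s t) - partial_deriv i f (?p s 0)", OF t(1) d1'] by blast
    have d2: "((\<lambda>r. partial_deriv i f (?p s r)) has_real_derivative
        partial_deriv j (partial_deriv i f) (?p s r)) (at r)"
      if "0 \<le> r" "r \<le> t" for r
      using line[of "partial_deriv i f" "x + s *\<^sub>R axis i 1" r j] that t s
        smooth_on_differentiable[OF smooth_on_partial_deriv[OF sm] inS] by simp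
    obtain r where r: "0 < r" "r < t"
      and r_eq: "partial_deriv i f (?p s t) - partial_deriv i f (?p s 0)
        = (t - 0) * partial_deriv j (partial_deriv i f) (?p s r)"
      using MVT2[of 0 t "\<lambda>r. partial_deriv i f (?p s r)"
          "\<lambda>r. partial_deriv j (partial_deriv i f) (?p s r)"] d2 t by blast
    from s_eq r_eq have "f (?p t t) - f (?p t 0) - f (?p 0 t) + f (?p 0 0)
        = t * t * partial_deriv j (partial_deriv i f) (?p s r)" by (simp add: algebra_simps)
    then show ?thesis using s r by auto
  qed
  then show ?thesis using e(1) by (intro exI[of _ "e/2"]) auto
qed

text \<open>Both mixed derivatives, each at some point within \<open>2 t\<close> of \<open>x\<close>, equal the same second
  difference divided by \<open>t\<^sup>2\<close>; by continuity they agree at \<open>x\<close>.\<close>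
lemma partial_deriv_commute:
  assumes "open S" "x \<in> S" and sm: "smooth_on S f"
  shows "partial_deriv i (partial_deriv j f) x = partial_deriv j (partial_deriv i f) x"
proof (rule ccontr)
  let ?F = "partial_deriv i (partial_deriv j f)" and ?G = "partial_deriv j (partial_deriv i f)"
  let ?\<epsilon> = "\<bar>?F x - ?G x\<bar> / 2"
  assume "?F x \<noteq> ?G x"
  then have pos: "?\<epsilon> > 0" by simp
  have near: "\<exists>\<delta>>0. \<forall>y. dist y x < \<delta> \<longrightarrow> \<bar>partial_deriv k (partial_deriv l f) y - partial_deriv k (partial_deriv l f) x\<bar> < ?\<epsilon>" for k l
  proof -
    have "isCont (partial_deriv k (partial_deriv l f)) x"
      using smooth_on_differentiable[OF smooth_on_partial_deriv[OF smooth_on_partial_deriv[OF sm]] assms(2)]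
      by (rule differentiable_imp_continuous_within)
    then show ?thesis using pos unfolding continuous_at_eps_delta dist_real_def by metis
  qed
  obtain d1 d2 where d: "d1 > 0" "d2 > 0"
    and d1: "\<And>y. dist y x < d1 \<Longrightarrow> \<bar>?F y - ?F x\<bar> < ?\<epsilon>"
    and d2: "\<And>y. dist y x < d2 \<Longrightarrow> \<bar>?G y - ?G x\<bar> < ?\<epsilon>"
    using near[of i j] near[of j i] by auto
  obtain d3 where d3: "d3 > 0" "\<And>t. 0 < t \<Longrightarrow> t < d3 \<Longrightarrow> \<exists>s r. 0 < s \<and> s < t \<and> 0 < r \<and> r < t \<and>
    f (x + t *\<^sub>R axis i 1 + t *\<^sub>R axis j 1) - f (x + t *\<^sub>R axis i 1) - f (x + t *\<^sub>R axis j 1) + f x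
    = t * t * ?G (x + s *\<^sub>R axis i 1 + r *\<^sub>R axis j 1)"
    using second_difference_eq_mixed_deriv[OF assms, of i j] by blast
  obtain d4 where d4: "d4 > 0" "\<And>t. 0 < t \<Longrightarrow> t < d4 \<Longrightarrow> \<exists>s r. 0 < s \<and> s < t \<and> 0 < r \<and> r < t \<and>
    f (x + t *\<^sub>R axis j 1 + t *\<^sub>R axis i 1) - f (x + t *\<^sub>R axis j 1) - f (x + t *\<^sub>R axis i 1) + f x
    = t * t * ?F (x + s *\<^sub>R axis j 1 + r *\<^sub>R axis i 1)"
    using second_difference_eq_mixed_deriv[OF assms, of j i] by blast
  define t where "t = Min {d1, d2, d3, d4} / 2"
  have t: "0 < t" "t < d3" "t < d4" "2 * t \<le> d1" "2 * t \<le> d2"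
    using d d3(1) d4(1) unfolding t_def by auto
  have close: "dist (x + s *\<^sub>R axis k 1 + r *\<^sub>R axis l 1) x < 2 * t"
    if "0 < s" "s < t" "0 < r" "r < t" for s r k l
    using norm_triangle_ineq[of "s *\<^sub>R axis k 1" "r *\<^sub>R axis l (1::real)"] that
    by (simp add: dist_norm add.assoc)
  obtain s r where 1: "0 < s" "s < t" "0 < r" "r < t"
    "f (x + t *\<^sub>R axis i 1 + t *\<^sub>R axis j 1) - f (x + t *\<^sub>R axis i 1) - f (x + t *\<^sub>R axis j 1) + f x
    = t * t * ?G (x + s *\<^sub>R axis i 1 + r *\<^sub>R axis j 1)"
    using d3(2)[OF t(1,2)] by blast
  obtain s' r' where 2: "0 < s'" "s' < t" "0 < r'" "r' < t"
    "f (x + t *\<^sub>R axis j 1 + t *\<^sub>R axis i 1) - f (x + t *\<^sub>R axis j 1) - f (x + t *\<^sub>R axis i 1) + f x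
    = t * t * ?F (x + s' *\<^sub>R axis j 1 + r' *\<^sub>R axis i 1)"
    using d4(2)[OF t(1,3)] by blast
  have "t * t * ?F (x + s' *\<^sub>R axis j 1 + r' *\<^sub>R axis i 1) = t * t * ?G (x + s *\<^sub>R axis i 1 + r *\<^sub>R axis j 1)"
    using 1(5) 2(5) unfolding add.assoc add.commute[of "t *\<^sub>R axis j 1" "t *\<^sub>R axis i 1"] by linarith
  then have "?F (x + s' *\<^sub>R axis j 1 + r' *\<^sub>R axis i 1) = ?G (x + s *\<^sub>R axis i 1 + r *\<^sub>R axis j 1)"
    using t(1) by simp
  moreover have "\<bar>?F (x + s' *\<^sub>R axis j 1 + r' *\<^sub>R axis i 1) - ?F x\<bar> < ?\<epsilon>"
    using d1 close[OF 2(1-4)] t(4) by (meson less_le_trans)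
  moreover have "\<bar>?G (x + s *\<^sub>R axis i 1 + r *\<^sub>R axis j 1) - ?G x\<bar> < ?\<epsilon>"
    using d2 close[OF 1(1-4)] t(5) by (meson less_le_trans)
  moreover have False if "a = b" "\<bar>a - c\<bar> < \<bar>c - d\<bar> / 2" "\<bar>b - d\<bar> < \<bar>c - d\<bar> / 2" for a b c d :: real
    using that by (auto simp: abs_if field_simps split: if_splits)
  ultimately show False by blast
qed

section \<open>The drift Laplacian on the plane\<close>

definition laplacian2 :: "(real ^ 2 \<Rightarrow> real) \<Rightarrow> real ^ 2 \<Rightarrow> real" where
  "laplacian2 u q = partial_deriv 1 (partial_deriv 1 u) q + partial_deriv 2 (partial_deriv 2 u) q"

definition grad_product :: "(real ^ 2 \<Rightarrow> real) \<Rightarrow> (real ^ 2 \<Rightarrow> real) \<Rightarrow> real ^ 2 \<Rightarrow> real" where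
  "grad_product u v q = partial_deriv 1 u q * partial_deriv 1 v q + partial_deriv 2 u q * partial_deriv 2 v q"

text \<open>This is \<open>\<psi>\<^sup>-\<^sup>2 div (\<psi>\<^sup>2 \<nabla>u)\<close>, the Laplacian of the plane with density \<open>\<psi>\<^sup>2\<close>.\<close>
definition weighted_laplacian :: "(real ^ 2 \<Rightarrow> real) \<Rightarrow> (real ^ 2 \<Rightarrow> real) \<Rightarrow> real ^ 2 \<Rightarrow> real" where
  "weighted_laplacian \<psi> u q = laplacian2 u q + 2 * grad_product \<psi> u q * inverse (\<psi> q)"

lemma smooth_on_laplacian2: "open S \<Longrightarrow> smooth_on S u \<Longrightarrow> smooth_on S (laplacian2 u)"
  unfolding laplacian2_def[abs_def] by (intro smooth_on_intros)

lemma smooth_on_grad_product: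
  "open S \<Longrightarrow> smooth_on S u \<Longrightarrow> smooth_on S v \<Longrightarrow> smooth_on S (grad_product u v)"
  unfolding grad_product_def[abs_def] by (intro smooth_on_intros)

lemma smooth_on_weighted_laplacian:
  assumes "open S" "smooth_on S \<psi>" "smooth_on S u" "\<And>q. q \<in> S \<Longrightarrow> \<psi> q \<noteq> 0"
  shows "smooth_on S (weighted_laplacian \<psi> u)"
  unfolding weighted_laplacian_def[abs_def]
  by (intro smooth_on_intros smooth_on_laplacian2 smooth_on_grad_product assms)

lemma laplacian2_cong:
  assumes "open S" "x \<in> S" "\<And>y. y \<in> S \<Longrightarrow> f y = g y"
  shows "laplacian2 f x = laplacian2 g x"
proof -
  have "partial_deriv i f y = partial_deriv i g y" if "y \<in> S" for y i
    by (rule partial_deriv_cong[OF assms(1) that assms(3)])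
  then show ?thesis
    unfolding laplacian2_def by (metis partial_deriv_cong[OF assms(1,2)])
qed

lemma laplacian2_add:
  "open S \<Longrightarrow> smooth_on S f \<Longrightarrow> smooth_on S g \<Longrightarrow> x \<in> S \<Longrightarrow>
    laplacian2 (\<lambda>y. f y + g y) x = laplacian2 f x + laplacian2 g x"
  by (simp add: laplacian2_def second_partial_deriv_add)

lemma laplacian2_mult:
  "open S \<Longrightarrow> smooth_on S f \<Longrightarrow> smooth_on S g \<Longrightarrow> x \<in> S \<Longrightarrow>
    laplacian2 (\<lambda>y. f y * g y) x = f x * laplacian2 g x + 2 * grad_product f g x + laplacian2 f x * g x"
  by (simp add: laplacian2_def grad_product_def second_partial_deriv_mult algebra_simps)

text \<open>Multiplication by \<open>\<psi>\<close> (the ground state transform) turns the drift Laplacian into a Schroedinger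
  operator without first-order terms, so that iterating it needs no derivatives of quotients.\<close>
lemma weighted_laplacian_conjugate:
  assumes "open S" "smooth_on S \<psi>" "smooth_on S u" "q \<in> S" "\<psi> q \<noteq> 0"
  shows "\<psi> q * weighted_laplacian \<psi> u q = laplacian2 (\<lambda>p. \<psi> p * u p) q - laplacian2 \<psi> q * u q"
  using assms by (simp add: laplacian2_mult weighted_laplacian_def field_simps)

text \<open>Apply the conjugation identity to \<open>u = E f\<close>, using \<open>\<psi> E f = 2 \<langle>\<nabla>\<psi>, \<nabla>f\<rangle>\<close> for harmonic \<open>f\<close>.\<close>
lemma weighted_bilaplacian_harmonic:
  assumes S: "open S" and sm: "smooth_on S \<psi>" "smooth_on S f" and q: "q \<in> S"
    and nz: "\<And>p. p \<in> S \<Longrightarrow> \<psi> p \<noteq> 0" and harm: "\<And>p. p \<in> S \<Longrightarrow> laplacian2 f p = 0"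
  shows "(\<psi> q)\<^sup>2 * weighted_laplacian \<psi> (weighted_laplacian \<psi> f) q
    = 2 * (\<psi> q * laplacian2 (grad_product \<psi> f) q - laplacian2 \<psi> q * grad_product \<psi> f q)"
proof -
  let ?E = "weighted_laplacian \<psi> f"
  have v: "\<psi> p * ?E p = 2 * grad_product \<psi> f p" if "p \<in> S" for p
    using harm[OF that] nz[OF that] by (simp add: weighted_laplacian_def)
  have "\<psi> q * weighted_laplacian \<psi> ?E q = laplacian2 (\<lambda>p. \<psi> p * ?E p) q - laplacian2 \<psi> q * ?E q"
    by (rule weighted_laplacian_conjugate[OF S sm(1) smooth_on_weighted_laplacian q nz])
      (use assms in auto)
  also have "laplacian2 (\<lambda>p. \<psi> p * ?E p) q = laplacian2 (\<lambda>p. 2 * grad_product \<psi> f p) q"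
    using laplacian2_cong[OF S q v] .
  also have "\<dots> = 2 * laplacian2 (grad_product \<psi> f) q"
    using laplacian2_mult[OF S smooth_on_const[OF S, of 2] smooth_on_grad_product[OF S sm] q]
    by (simp add: laplacian2_def grad_product_def)
  finally have eq: "\<psi> q * weighted_laplacian \<psi> ?E q
      = 2 * laplacian2 (grad_product \<psi> f) q - laplacian2 \<psi> q * ?E q" .
  have "(\<psi> q)\<^sup>2 * weighted_laplacian \<psi> ?E q
      = 2 * \<psi> q * laplacian2 (grad_product \<psi> f) q - laplacian2 \<psi> q * (\<psi> q * ?E q)"
    unfolding power2_eq_square mult.assoc eq by (simp add: algebra_simps)
  then show ?thesis using v[OF q] by (simp add: algebra_simps)
qed

section \<open>Pulling back along the projection\<close>

lemma bounded_linear_proj_xy: "bounded_linear proj_xy"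
proof -
  have "linear proj_xy"
    by (rule linearI) (simp_all add: proj_xy_def vec_eq_iff forall_2)
  then show ?thesis by (simp add: linear_conv_bounded_linear)
qed

lemma proj_xy_components [simp]: "proj_xy p $ 1 = p $ 1" "proj_xy p $ 2 = p $ 2"
  by (simp_all add: proj_xy_def)

lemma proj_xy_axis [simp]:
  "proj_xy (axis 1 1) = axis 1 1" "proj_xy (axis 2 1) = axis 2 1" "proj_xy (axis 3 1) = 0"
  by (simp_all add: vec_eq_iff forall_2 axis_def)

lemma proj_xy_surj: "\<exists>p. proj_xy p = q"
  by (rule exI[of _ "vector [q $ 1, q $ 2, 0]"]) (simp add: vec_eq_iff forall_2)

lemma open_cylinder: "open U \<Longrightarrow> open (cylinder U)"
  using continuous_open_vimage[OF _ linear_continuous_at[OF bounded_linear_proj_xy]]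
  by (simp add: cylinder_def vimage_def)

lemma cylinder_iff [simp]: "p \<in> cylinder U \<longleftrightarrow> proj_xy p \<in> U"
  by (simp add: cylinder_def)

lemma has_derivative_pullback:
  assumes "u differentiable (at (proj_xy p))"
  shows "((u \<circ> proj_xy) has_derivative (frechet_derivative u (at (proj_xy p)) \<circ> proj_xy)) (at p)"
  using diff_chain_at[OF bounded_linear_imp_has_derivative[OF bounded_linear_proj_xy]
      assms[unfolded frechet_derivative_works]] .

lemma partial_deriv_pullback:
  assumes "u differentiable (at (proj_xy p))"
  shows "partial_deriv 1 (u \<circ> proj_xy) p = partial_deriv 1 u (proj_xy p)"
    and "partial_deriv 2 (u \<circ> proj_xy) p = partial_deriv 2 u (proj_xy p)"
    and "partial_deriv 3 (u \<circ> proj_xy) p = 0"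
  using partial_deriv_eq[OF has_derivative_pullback[OF assms]]
    linear_0[OF linear_frechet_derivative[OF assms]]
  by (simp_all add: partial_deriv_def)

lemma smooth_on_pullback:
  assumes "open U" "smooth_on U u"
  shows "smooth_on (cylinder U) (u \<circ> proj_xy)"
proof (rule smooth_on_coinduct[of _ "\<lambda>w. \<exists>u. smooth_on U u \<and> w = u \<circ> proj_xy"])
  fix w assume "\<exists>u. smooth_on U u \<and> w = u \<circ> proj_xy"
  then obtain u where u: "smooth_on U u" "w = u \<circ> proj_xy" by blast
  have d: "u differentiable (at (proj_xy p))" if "p \<in> cylinder U" for p
    using smooth_on_differentiable[OF u(1)] that by simp
  show "(\<forall>p\<in>cylinder U. w differentiable at p) \<and> (\<forall>i. \<exists>g. (\<exists>u. smooth_on U u \<and> g = u \<circ> proj_xy) \<and>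
      (\<forall>p\<in>cylinder U. partial_deriv i w p = g p))"
  proof (intro conjI ballI allI)
    fix p assume "p \<in> cylinder U"
    then show "w differentiable at p"
      using has_derivative_pullback[OF d] u(2) unfolding differentiable_def by blast
  next
    fix i :: 3
    consider "i = 1" | "i = 2" | "i = 3" using exhaust_3 by blast
    then obtain u' where "smooth_on U u'"
      "\<And>p. p \<in> cylinder U \<Longrightarrow> partial_deriv i (u \<circ> proj_xy) p = u' (proj_xy p)"
      using partial_deriv_pullback[OF d] smooth_on_partial_deriv[OF u(1)]
        smooth_on_const[OF assms(1), of 0] by metis
    then show "\<exists>g. (\<exists>u. smooth_on U u \<and> g = u \<circ> proj_xy) \<and> (\<forall>p\<in>cylinder U. partial_deriv i w p = g p)"
      unfolding u(2) by (intro exI[of _ "u' \<circ> proj_xy"]) auto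
  qed
qed (use assms open_cylinder in auto)

lemma matrix_inv_unique:
  fixes A B :: "'a::comm_ring_1 ^ 'n::finite ^ 'n"
  assumes "A ** B = mat 1" "B ** A = mat 1"
  shows "matrix_inv A = B"
proof -
  have "A ** matrix_inv A = mat 1 \<and> matrix_inv A ** A = mat 1"
    unfolding matrix_inv_def using assms by (rule someI[of _ B, OF conjI])
  then have "matrix_inv A = matrix_inv A ** (A ** B)" "matrix_inv A ** A = mat 1"
    using assms by (simp_all add: matrix_mul_rid)
  then show ?thesis by (simp add: matrix_mul_assoc matrix_mul_lid)
qed

lemma laplace_beltrami_flat: "laplace_beltrami flat_metric u q = laplacian2 u q"
proof -
  have "matrix_inv (mat 1) = (mat 1 :: real ^ 2 ^ 2)"
    by (rule matrix_inv_unique) (simp_all add: matrix_mul_lid)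
  then show ?thesis
    by (simp add: laplace_beltrami_def flat_metric_def laplacian2_def sum_2 mat_def det_2)
qed

lemma det_warped_metric: "det (warped_metric \<beta> p) = \<beta> (proj_xy p) powi (-2)"
  by (simp add: warped_metric_def det_3)

lemma matrix_inv_warped_metric:
  assumes "\<beta> (proj_xy p) \<noteq> 0"
  shows "matrix_inv (warped_metric \<beta> p) = vector [vector [1, 0, 0], vector [0, 1, 0],
    vector [0, 0, (\<beta> (proj_xy p))\<^sup>2]]"
  using assms
  by (intro matrix_inv_unique)
    (simp_all add: warped_metric_def matrix_matrix_mult_def mat_def vec_eq_iff forall_3 sum_3
      power_int_minus)

lemma laplace_beltrami_cong:
  assumes "open S" "x \<in> S" "\<And>y. y \<in> S \<Longrightarrow> u y = v y"
  shows "laplace_beltrami g u x = laplace_beltrami g v x"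
proof -
  have "partial_deriv i (\<lambda>y. sqrt (det (g y)) * (\<Sum>j\<in>UNIV. matrix_inv (g y) $ i $ j * partial_deriv j u y)) x
    = partial_deriv i (\<lambda>y. sqrt (det (g y)) * (\<Sum>j\<in>UNIV. matrix_inv (g y) $ i $ j * partial_deriv j v y)) x" for i
  proof (rule partial_deriv_cong[OF assms(1,2)])
    fix y assume "y \<in> S"
    then have "partial_deriv j u y = partial_deriv j v y" for j
      using partial_deriv_cong[OF assms(1)] assms(3) by blast
    then show "sqrt (det (g y)) * (\<Sum>j\<in>UNIV. matrix_inv (g y) $ i $ j * partial_deriv j u y)
      = sqrt (det (g y)) * (\<Sum>j\<in>UNIV. matrix_inv (g y) $ i $ j * partial_deriv j v y)" by simp
  qed
  then show ?thesis unfolding laplace_beltrami_def by simp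
qed

text \<open>With \<open>g\<close> the warped metric, \<open>sqrt (det g) = \<psi>\<^sup>2\<close> and \<open>g\<close> is the identity in the horizontal directions,
  so the flux of a pulled back function is the pullback of \<open>\<psi>\<^sup>2 \<nabla>u\<close>, with no vertical component.
  Squaring \<open>\<psi>\<close> makes the formula hold for either sign of \<open>\<psi>\<close>.\<close>
lemma laplace_beltrami_pullback:
  assumes U: "open U" and sm: "smooth_on U \<psi>" "smooth_on U u"
    and nz: "\<And>q. q \<in> U \<Longrightarrow> \<psi> q \<noteq> 0" and \<beta>: "\<And>q. q \<in> U \<Longrightarrow> \<beta> q = \<psi> q powi (-2)"
    and p: "p \<in> cylinder U"
  shows "laplace_beltrami (warped_metric \<beta>) (u \<circ> proj_xy) p = weighted_laplacian \<psi> u (proj_xy p)"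
proof -
  let ?u = "u \<circ> proj_xy"
  let ?flux = "\<lambda>i y. sqrt (det (warped_metric \<beta> y)) *
    (\<Sum>j\<in>UNIV. matrix_inv (warped_metric \<beta> y) $ i $ j * partial_deriv j ?u y)"
  let ?h = "\<lambda>i q. \<psi> q * \<psi> q * partial_deriv i u q"
  have sqrt_det: "sqrt (det (warped_metric \<beta> y)) = \<psi> (proj_xy y) * \<psi> (proj_xy y)" if "y \<in> cylinder U" for y
  proof -
    have "det (warped_metric \<beta> y) = (\<psi> (proj_xy y) * \<psi> (proj_xy y))\<^sup>2"
      using \<beta>[of "proj_xy y"] that
      by (simp add: det_warped_metric power_int_minus power2_eq_square)
    then show ?thesis by (simp only: real_sqrt_abs) simp
  qed
  have flux: "?flux 1 y = (?h 1 \<circ> proj_xy) y" "?flux 2 y = (?h 2 \<circ> proj_xy) y" "?flux 3 y = 0"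
    if y: "y \<in> cylinder U" for y
  proof -
    have d: "u differentiable (at (proj_xy y))" using smooth_on_differentiable[OF sm(2)] y by simp
    have "\<beta> (proj_xy y) \<noteq> 0" using \<beta> nz y by simp
    then show "?flux 1 y = (?h 1 \<circ> proj_xy) y" "?flux 2 y = (?h 2 \<circ> proj_xy) y" "?flux 3 y = 0"
      using sqrt_det[OF y]
      by (simp_all add: matrix_inv_warped_metric sum_3 partial_deriv_pullback[OF d])
  qed
  have sh: "smooth_on U (?h i)" for i by (intro smooth_on_intros U sm)
  have q: "proj_xy p \<in> U" using p by simp
  have dh: "?h i differentiable (at (proj_xy p))" for i
    using smooth_on_differentiable[OF sh q] .
  have pd_h: "partial_deriv i (?h i) (proj_xy p) = \<psi> (proj_xy p) * \<psi> (proj_xy p) * partial_deriv i (partial_deriv i u) (proj_xy p)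
      + 2 * \<psi> (proj_xy p) * partial_deriv i \<psi> (proj_xy p) * partial_deriv i u (proj_xy p)" for i
    using smooth_partial_deriv_mult[OF smooth_on_mult[OF U sm(1) sm(1)] smooth_on_partial_deriv[OF sm(2)] q]
    by (simp add: smooth_partial_deriv_mult[OF sm(1) sm(1) q] algebra_simps)
  have 1: "partial_deriv 1 (?flux 1) p = partial_deriv 1 (?h 1) (proj_xy p)"
    by (rule trans[OF partial_deriv_cong[OF open_cylinder[OF U] p flux(1)] partial_deriv_pullback(1)[OF dh]])
  have 2: "partial_deriv 2 (?flux 2) p = partial_deriv 2 (?h 2) (proj_xy p)"
    by (rule trans[OF partial_deriv_cong[OF open_cylinder[OF U] p flux(2)] partial_deriv_pullback(2)[OF dh]])
  have 3: "partial_deriv 3 (?flux 3) p = 0"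
    using partial_deriv_cong[OF open_cylinder[OF U] p flux(3)] by simp
  have "laplace_beltrami (warped_metric \<beta>) ?u p
    = (partial_deriv 1 (?flux 1) p + partial_deriv 2 (?flux 2) p + partial_deriv 3 (?flux 3) p)
      / sqrt (det (warped_metric \<beta> p))"
    unfolding laplace_beltrami_def sum_3 ..
  also have "\<dots> = weighted_laplacian \<psi> u (proj_xy p)"
    unfolding 1 2 3 pd_h sqrt_det[OF p]
    using nz[OF q] by (simp add: weighted_laplacian_def laplacian2_def grad_product_def field_simps)
  finally show ?thesis .
qed

lemma biharmonic_pullback_iff:
  assumes U: "open U" and sm: "smooth_on U \<psi>"
    and nz: "\<And>q. q \<in> U \<Longrightarrow> \<psi> q \<noteq> 0" and \<beta>: "\<And>q. q \<in> U \<Longrightarrow> \<beta> q = \<psi> q powi (-2)"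
    and f: "harmonic_on flat_metric U f"
  shows "biharmonic_on (warped_metric \<beta>) (cylinder U) (f \<circ> proj_xy) \<longleftrightarrow>
    (\<forall>q\<in>U. \<psi> q * laplacian2 (grad_product \<psi> f) q = laplacian2 \<psi> q * grad_product \<psi> f q)"
proof -
  have smf: "smooth_on U f" and harm: "\<And>q. q \<in> U \<Longrightarrow> laplacian2 f q = 0"
    using f by (auto simp: harmonic_on_def laplace_beltrami_flat)
  let ?E = "weighted_laplacian \<psi>"
  have sE: "smooth_on U (?E f)" by (rule smooth_on_weighted_laplacian[OF U sm smf nz])
  have "laplace_beltrami (warped_metric \<beta>) (laplace_beltrami (warped_metric \<beta>) (f \<circ> proj_xy)) p = ?E (?E f) (proj_xy p)"
    if p: "p \<in> cylinder U" for p
  proof -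
    have "laplace_beltrami (warped_metric \<beta>) (laplace_beltrami (warped_metric \<beta>) (f \<circ> proj_xy)) p
      = laplace_beltrami (warped_metric \<beta>) (?E f \<circ> proj_xy) p"
      using laplace_beltrami_pullback[OF U sm smf nz \<beta>]
      by (intro laplace_beltrami_cong[OF open_cylinder[OF U] p]) simp
    also have "\<dots> = ?E (?E f) (proj_xy p)"
      by (rule laplace_beltrami_pullback[OF U sm sE nz \<beta> p])
    finally show ?thesis .
  qed
  then have "biharmonic_on (warped_metric \<beta>) (cylinder U) (f \<circ> proj_xy) \<longleftrightarrow>
      (\<forall>p\<in>cylinder U. ?E (?E f) (proj_xy p) = 0)"
    using smooth_on_pullback[OF U smf] by (simp add: biharmonic_on_def)
  also have "\<dots> \<longleftrightarrow> (\<forall>q\<in>U. ?E (?E f) q = 0)"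
    using proj_xy_surj by (metis cylinder_iff)
  also have "\<dots> \<longleftrightarrow> (\<forall>q\<in>U. \<psi> q * laplacian2 (grad_product \<psi> f) q = laplacian2 \<psi> q * grad_product \<psi> f q)"
    using weighted_bilaplacian_harmonic[OF U sm smf _ nz harm] nz by force
  finally show ?thesis .
qed

section \<open>The biharmonicity condition characterises affine functions\<close>

lemma laplacian2_partial_deriv:
  assumes S: "open S" and sm: "smooth_on S f" and q: "q \<in> S"
  shows "laplacian2 (partial_deriv i f) q = partial_deriv i (laplacian2 f) q"
proof -
  have "partial_deriv j (partial_deriv j (partial_deriv i f)) q
      = partial_deriv i (partial_deriv j (partial_deriv j f)) q" for j
  proof -
    have "partial_deriv j (partial_deriv j (partial_deriv i f)) q
      = partial_deriv j (partial_deriv i (partial_deriv j f)) q"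
      by (rule partial_deriv_cong[OF S q partial_deriv_commute[OF S _ sm]])
    also have "\<dots> = partial_deriv i (partial_deriv j (partial_deriv j f)) q"
      by (rule partial_deriv_commute[OF S q smooth_on_partial_deriv[OF sm]])
    finally show ?thesis .
  qed
  moreover have "partial_deriv i (laplacian2 f) q = partial_deriv i (partial_deriv 1 (partial_deriv 1 f)) q
      + partial_deriv i (partial_deriv 2 (partial_deriv 2 f)) q"
    unfolding laplacian2_def[abs_def]
    by (rule smooth_partial_deriv_add[OF _ _ q]; intro smooth_on_intros S sm)
  ultimately show ?thesis by (simp add: laplacian2_def)
qed

lemma constant_on_if_partial_derivs_zero:
  assumes "open S" "connected S" "\<And>x. x \<in> S \<Longrightarrow> f differentiable (at x)"
    and zero: "\<And>x i. x \<in> S \<Longrightarrow> partial_deriv i f x = 0"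
  shows "f constant_on S"
proof (rule has_derivative_zero_connected_constant_on[of S "{}"])
  show "continuous_on S f"
    using assms(3) by (meson continuous_at_imp_continuous_on differentiable_imp_continuous_within)
  show "\<forall>x\<in>S - {}. (f has_derivative (\<lambda>h. 0)) (at x within S)"
  proof
    fix x assume "x \<in> S - {}"
    then have x: "x \<in> S" by simp
    have "frechet_derivative f (at x) h = 0" for h
    proof -
      have lin: "linear (frechet_derivative f (at x))"
        using assms(3)[OF x] by (rule linear_frechet_derivative)
      have "h = (\<Sum>i\<in>UNIV. (h $ i) *\<^sub>R axis i 1)"
        by (simp add: vec_eq_iff axis_def if_distrib cong: if_cong)
      then have "frechet_derivative f (at x) h = frechet_derivative f (at x) (\<Sum>i\<in>UNIV. (h $ i) *\<^sub>R axis i 1)"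
        by simp
      also have "\<dots> = (\<Sum>i\<in>UNIV. (h $ i) *\<^sub>R frechet_derivative f (at x) (axis i 1))"
        using lin by (simp add: linear_sum linear_scale)
      also have "\<dots> = 0" using zero[OF x] by (simp add: partial_deriv_def)
      finally show ?thesis .
    qed
    then have "frechet_derivative f (at x) = (\<lambda>h. 0)" by blast
    then show "(f has_derivative (\<lambda>h. 0)) (at x within S)"
      using assms(3)[OF x] by (metis frechet_derivative_works has_derivative_at_withinI)
  qed
qed (use assms in auto)

lemma affine_if_hessian_zero:
  fixes \<psi> :: "real ^ 2 \<Rightarrow> real"
  assumes S: "open S" "connected S" and sm: "smooth_on S \<psi>"
    and zero: "\<And>q i j. q \<in> S \<Longrightarrow> partial_deriv i (partial_deriv j \<psi>) q = 0"
  obtains a b c where "\<And>q. q \<in> S \<Longrightarrow> \<psi> q = a * q $ 1 + b * q $ 2 + c"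
proof -
  have "partial_deriv j \<psi> constant_on S" for j
    by (rule constant_on_if_partial_derivs_zero[OF S])
      (auto intro: zero smooth_on_differentiable smooth_on_partial_deriv[OF sm])
  then obtain g where g: "\<And>j q. q \<in> S \<Longrightarrow> partial_deriv j \<psi> q = g j"
    unfolding constant_on_def by metis
  let ?l = "\<lambda>q :: real ^ 2. g 1 * q $ 1 + g 2 * q $ 2"
  have sl: "smooth_on S ?l" by (intro smooth_on_intros S)
  have "(\<lambda>q. \<psi> q - ?l q) constant_on S"
  proof (rule constant_on_if_partial_derivs_zero[OF S])
    show "(\<lambda>q. \<psi> q - ?l q) differentiable (at q)" if "q \<in> S" for q
      using that by (intro smooth_on_differentiable[of S] smooth_on_intros S sm)
  next
    fix q i assume q: "q \<in> S"
    have "partial_deriv i ?l q = g 1 * (if i = 1 then 1 else 0) + g 2 * (if i = 2 then 1 else 0)"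
      by (simp add: partial_deriv_add partial_deriv_mult differentiable_component)
    also have "\<dots> = g i" using exhaust_2[of i] by auto
    finally show "partial_deriv i (\<lambda>q. \<psi> q - ?l q) q = 0"
      using partial_deriv_diff[OF smooth_on_differentiable[OF sm q] smooth_on_differentiable[OF sl q]] g[OF q]
      by simp
  qed
  then obtain c where "\<And>q. q \<in> S \<Longrightarrow> \<psi> q - ?l q = c" unfolding constant_on_def by blast
  then have "\<psi> q = g 1 * q $ 1 + g 2 * q $ 2 + c" if "q \<in> S" for q
    using that by (force simp: algebra_simps)
  then show ?thesis using that by blast
qed

text \<open>The condition is tested on the harmonic functions \<open>x\<close>, \<open>y\<close>, \<open>xy\<close> and \<open>x\<^sup>2 - y\<^sup>2\<close>, whose gradients and
  Hessians span all possible first derivatives and trace-free Hessians at each point.\<close>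
lemma affine_if_biharmonic_condition:
  assumes S: "open S" "connected S" and sm: "smooth_on S \<psi>"
    and nz: "\<And>q. q \<in> S \<Longrightarrow> \<psi> q \<noteq> 0" and nc: "\<not> \<psi> constant_on S"
    and bi: "\<And>f q. harmonic_on flat_metric S f \<Longrightarrow> q \<in> S \<Longrightarrow>
      \<psi> q * laplacian2 (grad_product \<psi> f) q = laplacian2 \<psi> q * grad_product \<psi> f q"
  obtains a b c where "\<And>q. q \<in> S \<Longrightarrow> \<psi> q = a * q $ 1 + b * q $ 2 + c"
proof -
  note sm1 = smooth_on_partial_deriv[OF sm]
  let ?x = "\<lambda>q :: real ^ 2. q $ 1" and ?y = "\<lambda>q :: real ^ 2. q $ 2"
  have smxy: "smooth_on S ?x" "smooth_on S ?y" by (intro smooth_on_intros S)+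
  have lin: "\<psi> q * laplacian2 (partial_deriv i \<psi>) q = laplacian2 \<psi> q * partial_deriv i \<psi> q"
    if "q \<in> S" for i q
  proof -
    have "harmonic_on flat_metric S (\<lambda>q. q $ i)"
      by (auto simp: harmonic_on_def laplace_beltrami_flat laplacian2_def intro: smooth_on_intros S)
    moreover have "grad_product \<psi> (\<lambda>q. q $ i) = partial_deriv i \<psi>"
      using exhaust_2[of i] by (auto simp: grad_product_def fun_eq_iff)
    ultimately show ?thesis using bi[OF _ that, of "\<lambda>q. q $ i"] by simp
  qed
  \<comment> \<open>\<open>f = xy\<close> isolates the off-diagonal part of the Hessian; the terms carrying \<open>x\<close> and \<open>y\<close> as
    factors cancel by \<open>lin\<close>.\<close>
  have mixed: "partial_deriv 2 (partial_deriv 1 \<psi>) q = 0" "partial_deriv 1 (partial_deriv 2 \<psi>) q = 0"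
    if q: "q \<in> S" for q
  proof -
    let ?f = "\<lambda>q. ?x q * ?y q"
    have pd: "partial_deriv 1 ?f = ?y" "partial_deriv 2 ?f = ?x"
      by (simp_all add: fun_eq_iff partial_deriv_mult differentiable_component)
    have "harmonic_on flat_metric S ?f"
      unfolding harmonic_on_def laplace_beltrami_flat
      by (intro conjI smooth_on_intros S) (simp add: laplacian2_def pd)
    moreover have "grad_product \<psi> ?f = (\<lambda>q. partial_deriv 1 \<psi> q * ?y q + partial_deriv 2 \<psi> q * ?x q)"
      by (simp add: fun_eq_iff grad_product_def pd)
    moreover have "laplacian2 (\<lambda>q. partial_deriv 1 \<psi> q * ?y q + partial_deriv 2 \<psi> q * ?x q) q
      = 2 * partial_deriv 2 (partial_deriv 1 \<psi>) q + laplacian2 (partial_deriv 1 \<psi>) q * ?y q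
      + 2 * partial_deriv 1 (partial_deriv 2 \<psi>) q + laplacian2 (partial_deriv 2 \<psi>) q * ?x q"
      using laplacian2_add[OF S(1) smooth_on_mult[OF S(1) sm1 smxy(2)] smooth_on_mult[OF S(1) sm1 smxy(1)] q, of 1 2]
        laplacian2_mult[OF S(1) sm1 smxy(2) q, of 1] laplacian2_mult[OF S(1) sm1 smxy(1) q, of 2]
      by (simp add: laplacian2_def[of ?x] laplacian2_def[of ?y] grad_product_def)
    ultimately have "\<psi> q * (2 * partial_deriv 2 (partial_deriv 1 \<psi>) q + 2 * partial_deriv 1 (partial_deriv 2 \<psi>) q)
      = (laplacian2 \<psi> q * partial_deriv 1 \<psi> q - \<psi> q * laplacian2 (partial_deriv 1 \<psi>) q) * ?y q
      + (laplacian2 \<psi> q * partial_deriv 2 \<psi> q - \<psi> q * laplacian2 (partial_deriv 2 \<psi>) q) * ?x q"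
      using bi[of ?f, OF _ q] by (simp add: algebra_simps)
    then have "partial_deriv 2 (partial_deriv 1 \<psi>) q + partial_deriv 1 (partial_deriv 2 \<psi>) q = 0"
      using lin[OF q] nz[OF q] by simp
    then show "partial_deriv 2 (partial_deriv 1 \<psi>) q = 0" "partial_deriv 1 (partial_deriv 2 \<psi>) q = 0"
      using partial_deriv_commute[OF S(1) q sm, of 1 2] by simp_all
  qed
  \<comment> \<open>\<open>f = x\<^sup>2 - y\<^sup>2\<close> isolates the difference of the diagonal entries in the same way.\<close>
  have equal: "partial_deriv 2 (partial_deriv 2 \<psi>) q = partial_deriv 1 (partial_deriv 1 \<psi>) q"
    if q: "q \<in> S" for q
  proof -
    let ?f = "\<lambda>q. ?x q * ?x q - ?y q * ?y q"
    have pd: "partial_deriv 1 ?f = (\<lambda>q. 2 * ?x q)" "partial_deriv 2 ?f = (\<lambda>q. -2 * ?y q)"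
      by (simp_all add: fun_eq_iff partial_deriv_diff partial_deriv_mult differentiable_component)
    have harmonic: "harmonic_on flat_metric S ?f"
      unfolding harmonic_on_def laplace_beltrami_flat
    proof (intro conjI)
      show "smooth_on S ?f" by (intro smooth_on_intros S)
      show "\<forall>q\<in>S. laplacian2 ?f q = 0"
        unfolding laplacian2_def pd partial_deriv_cmult_component by simp
    qed
    have product: "grad_product \<psi> ?f
        = (\<lambda>q. partial_deriv 1 \<psi> q * (2 * ?x q) + partial_deriv 2 \<psi> q * (-2 * ?y q))"
      by (simp add: fun_eq_iff grad_product_def pd)
    have laplacian: "laplacian2 (\<lambda>q. partial_deriv 1 \<psi> q * (2 * ?x q) + partial_deriv 2 \<psi> q * (-2 * ?y q)) q
      = 4 * partial_deriv 1 (partial_deriv 1 \<psi>) q + laplacian2 (partial_deriv 1 \<psi>) q * (2 * ?x q)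
      - 4 * partial_deriv 2 (partial_deriv 2 \<psi>) q - laplacian2 (partial_deriv 2 \<psi>) q * (2 * ?y q)"
    proof -
      have sm2: "smooth_on S (\<lambda>q. 2 * ?x q)" "smooth_on S (\<lambda>q. -2 * ?y q)"
        by (intro smooth_on_intros S)+
      have grad: "laplacian2 (\<lambda>q. 2 * ?x q) q = 0" "laplacian2 (\<lambda>q. -2 * ?y q) q = 0"
        "grad_product u (\<lambda>q. 2 * ?x q) q = 2 * partial_deriv 1 u q"
        "grad_product u (\<lambda>q. -2 * ?y q) q = -2 * partial_deriv 2 u q" for u
        unfolding laplacian2_def grad_product_def partial_deriv_cmult_component by simp_all
      show ?thesis
        using laplacian2_add[OF S(1) smooth_on_mult[OF S(1) sm1 sm2(1)] smooth_on_mult[OF S(1) sm1 sm2(2)] q, of 1 2]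
          laplacian2_mult[OF S(1) sm1 sm2(1) q, of 1] laplacian2_mult[OF S(1) sm1 sm2(2) q, of 2]
        unfolding grad by simp
    qed
    have "\<psi> q * (4 * partial_deriv 1 (partial_deriv 1 \<psi>) q - 4 * partial_deriv 2 (partial_deriv 2 \<psi>) q)
      = (laplacian2 \<psi> q * partial_deriv 1 \<psi> q - \<psi> q * laplacian2 (partial_deriv 1 \<psi>) q) * (2 * ?x q)
      - (laplacian2 \<psi> q * partial_deriv 2 \<psi> q - \<psi> q * laplacian2 (partial_deriv 2 \<psi>) q) * (2 * ?y q)"
      using bi[OF harmonic q] unfolding product laplacian by (simp add: algebra_simps)
    then show ?thesis using lin[OF q] nz[OF q] by simp
  qed
  let ?K = "partial_deriv 1 (partial_deriv 1 \<psi>)"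
  \<comment> \<open>The Hessian is now \<open>K\<close> times the identity.  Either derivative of \<open>K\<close> can be rewritten, through
    one of the two expressions for \<open>K\<close>, as a derivative of a mixed second derivative.\<close>
  have dK: "partial_deriv i ?K q = 0" if q: "q \<in> S" for i q
  proof -
    have "partial_deriv 2 ?K q = partial_deriv 1 (partial_deriv 2 (partial_deriv 1 \<psi>)) q"
      by (rule partial_deriv_commute[OF S(1) q sm1])
    also have "\<dots> = 0" using partial_deriv_cong[OF S(1) q mixed(1)] by simp
    finally have "partial_deriv 2 ?K q = 0" .
    moreover have "partial_deriv 1 ?K q = 0"
    proof -
      have "partial_deriv 1 ?K q = partial_deriv 1 (partial_deriv 2 (partial_deriv 2 \<psi>)) q"
        by (rule partial_deriv_cong[OF S(1) q equal[symmetric]])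
      also have "\<dots> = partial_deriv 2 (partial_deriv 1 (partial_deriv 2 \<psi>)) q"
        by (rule partial_deriv_commute[OF S(1) q sm1])
      also have "\<dots> = 0" using partial_deriv_cong[OF S(1) q mixed(2)] by simp
      finally show ?thesis .
    qed
    ultimately show ?thesis using exhaust_2[of i] by auto
  qed
  have lap: "laplacian2 \<psi> q = 2 * ?K q" if "q \<in> S" for q
    using equal[OF that] by (simp add: laplacian2_def)
  have Kgrad: "?K q * partial_deriv i \<psi> q = 0" if q: "q \<in> S" for i q
  proof -
    have "laplacian2 (partial_deriv i \<psi>) q = partial_deriv i (laplacian2 \<psi>) q"
      by (rule laplacian2_partial_deriv[OF S(1) sm q])
    also have "\<dots> = partial_deriv i (\<lambda>q. 2 * ?K q) q"
      by (rule partial_deriv_cong[OF S(1) q lap])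
    also have "\<dots> = 0"
      using smooth_partial_deriv_mult[OF smooth_on_const[OF S(1), of 2] smooth_on_partial_deriv[OF sm1] q]
        dK[OF q] by simp
    finally show ?thesis using lin[OF q, of i] lap[OF q] by simp
  qed
  have "?K constant_on S"
    by (rule constant_on_if_partial_derivs_zero[OF S])
      (auto intro: dK smooth_on_differentiable smooth_on_partial_deriv[OF sm1])
  then obtain k where k: "\<And>q. q \<in> S \<Longrightarrow> ?K q = k" unfolding constant_on_def by blast
  have "k = 0"
  proof (rule ccontr)
    assume "k \<noteq> 0"
    then have "partial_deriv i \<psi> q = 0" if "q \<in> S" for i q
      using Kgrad[OF that] k[OF that] by simp
    then have "\<psi> constant_on S"
      using constant_on_if_partial_derivs_zero[OF S] smooth_on_differentiable[OF sm] by blast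
    with nc show False ..
  qed
  then have "partial_deriv i (partial_deriv j \<psi>) q = 0" if "q \<in> S" for i j q
    using exhaust_2[of i] exhaust_2[of j] mixed[OF that] equal[OF that] k[OF that] by auto
  from affine_if_hessian_zero[OF S sm this] that show ?thesis by blast
qed

section \<open>Generalized harmonic morphisms\<close>

text \<open>For affine \<open>\<psi>\<close>, \<open>\<langle>\<nabla>\<psi>, \<nabla>f\<rangle>\<close> is a constant-coefficient derivative of the harmonic function \<open>f\<close>, hence
  harmonic, and \<open>\<Delta>\<psi> = 0\<close>: both sides of the biharmonicity condition vanish.\<close>
lemma generalized_harmonic_morphism_if_affine:
  assumes D: "open D" and nz: "\<And>q. q \<in> D \<Longrightarrow> a * q $ 1 + b * q $ 2 + c \<noteq> 0"
    and \<beta>: "\<And>q. q \<in> D \<Longrightarrow> \<beta> q = (a * q $ 1 + b * q $ 2 + c) powi (-2)"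
  shows "generalized_harmonic_morphism (cylinder D) (warped_metric \<beta>) D flat_metric proj_xy"
  unfolding generalized_harmonic_morphism_def
proof (intro conjI allI impI)
  show "proj_xy ` cylinder D \<subseteq> D" by auto
next
  fix i :: 2
  have "smooth_on (cylinder D) ((\<lambda>q. q $ i) \<circ> proj_xy)"
    by (intro smooth_on_pullback smooth_on_intros D)
  then show "smooth_on (cylinder D) (\<lambda>p. proj_xy p $ i)" by (simp add: o_def)
next
  fix U f
  assume "open U \<and> U \<subseteq> D \<and> cylinder D \<inter> proj_xy -` U \<noteq> {} \<and> harmonic_on flat_metric U f"
  then have U: "open U" "U \<subseteq> D" and f: "harmonic_on flat_metric U f" by auto
  then have sm: "smooth_on U f" and harm: "\<And>q. q \<in> U \<Longrightarrow> laplacian2 f q = 0"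
    by (auto simp: harmonic_on_def laplace_beltrami_flat)
  let ?\<psi> = "\<lambda>q :: real ^ 2. a * q $ 1 + b * q $ 2 + c"
  have pd: "partial_deriv 1 ?\<psi> = (\<lambda>q. a)" "partial_deriv 2 ?\<psi> = (\<lambda>q. b)"
    by (simp_all add: fun_eq_iff partial_deriv_add partial_deriv_mult differentiable_component)
  have "laplacian2 (grad_product ?\<psi> f) q = 0" if q: "q \<in> U" for q
  proof -
    have pd_harm: "laplacian2 (partial_deriv i f) q = 0" for i
      using laplacian2_partial_deriv[OF U(1) sm q] partial_deriv_cong[OF U(1) q harm] by simp
    have "grad_product ?\<psi> f = (\<lambda>q. a * partial_deriv 1 f q + b * partial_deriv 2 f q)"
      by (simp add: fun_eq_iff grad_product_def pd)
    then have "laplacian2 (grad_product ?\<psi> f) q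
      = laplacian2 (\<lambda>q. a * partial_deriv 1 f q) q + laplacian2 (\<lambda>q. b * partial_deriv 2 f q) q"
      by (simp only:) (rule laplacian2_add[OF U(1) _ _ q]; intro smooth_on_intros U sm)
    also have "\<dots> = 0"
      using pd_harm laplacian2_mult[OF U(1) smooth_on_const[OF U(1)] smooth_on_partial_deriv[OF sm] q]
      by (simp add: laplacian2_def[of "\<lambda>q. _"] grad_product_def)
    finally show ?thesis .
  qed
  moreover have "laplacian2 ?\<psi> q = 0" for q by (simp add: laplacian2_def pd)
  moreover have "cylinder D \<inter> proj_xy -` U = cylinder U" using U by auto
  moreover have "smooth_on U ?\<psi>" by (intro smooth_on_intros U)
  moreover have "?\<psi> q \<noteq> 0" "\<beta> q = ?\<psi> q powi (-2)" if "q \<in> U" for q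
    using nz \<beta> U(2) that by blast+
  ultimately show "biharmonic_on (warped_metric \<beta>) (cylinder D \<inter> proj_xy -` U) (f \<circ> proj_xy)"
    using biharmonic_pullback_iff[OF U(1) _ _ _ f, of ?\<psi> \<beta>] by simp
qed

text \<open>The test functions are harmonic on the whole plane, so \<open>U = D\<close> suffices; the analysis is then
  that of \<open>\<psi> = \<beta>\<^sup>-\<^sup>1\<^sup>/\<^sup>2\<close>.\<close>
lemma affine_if_generalized_harmonic_morphism:
  assumes D: "open D" "connected D" and sm: "smooth_on D \<beta>"
    and pos: "\<And>q. q \<in> D \<Longrightarrow> \<beta> q > 0" and nc: "\<not> \<beta> constant_on D"
    and ghm: "generalized_harmonic_morphism (cylinder D) (warped_metric \<beta>) D flat_metric proj_xy"
  obtains a b c where "\<And>q. q \<in> D \<Longrightarrow> \<beta> q = (a * q $ 1 + b * q $ 2 + c) powi (-2)"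
proof -
  define \<psi> where "\<psi> q = \<beta> q powr (-1/2)" for q
  have sm\<psi>: "smooth_on D \<psi>" unfolding \<psi>_def[abs_def] by (rule smooth_on_powr[OF D(1) sm pos])
  have nz: "\<psi> q \<noteq> 0" if "q \<in> D" for q using pos[OF that] by (simp add: \<psi>_def)
  have \<beta>: "\<beta> q = \<psi> q powi (-2)" if "q \<in> D" for q
  proof -
    have "\<psi> q * \<psi> q = \<beta> q powr (-1)" by (simp add: \<psi>_def flip: powr_add)
    also have "\<dots> = inverse (\<beta> q)" using pos[OF that] by (simp add: powr_minus)
    finally show ?thesis by (simp add: power_int_minus power2_eq_square)
  qed
  have nc\<psi>: "\<not> \<psi> constant_on D"
    using nc \<beta> unfolding constant_on_def by metis
  have "D \<noteq> {}" using nc by (auto simp: constant_on_def)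
  then have ne: "cylinder D \<inter> proj_xy -` D \<noteq> {}"
    using proj_xy_surj by (metis IntI cylinder_iff empty_iff equals0I vimageI2)
  have cyl: "cylinder D \<inter> proj_xy -` D = cylinder D" by auto
  have bi: "\<psi> q * laplacian2 (grad_product \<psi> f) q = laplacian2 \<psi> q * grad_product \<psi> f q"
    if "harmonic_on flat_metric D f" "q \<in> D" for f q
  proof -
    have "biharmonic_on (warped_metric \<beta>) (cylinder D) (f \<circ> proj_xy)"
      using ghm D(1) ne that(1) unfolding generalized_harmonic_morphism_def by (metis cyl order.refl)
    then show ?thesis
      using biharmonic_pullback_iff[OF D(1) sm\<psi> nz \<beta> that(1)] that(2) by blast
  qed
  obtain a b c where "\<And>q. q \<in> D \<Longrightarrow> \<psi> q = a * q $ 1 + b * q $ 2 + c"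
    using affine_if_biharmonic_condition[OF D sm\<psi> nz nc\<psi> bi] by blast
  then show ?thesis using that \<beta> by metis
qed

theorem theorem2p7:
  fixes D :: "(real ^ 2) set" and \<beta> :: "real ^ 2 \<Rightarrow> real"
  assumes "open D" and "connected D"
    and "smooth_on D \<beta>" and "\<And>p. p \<in> D \<Longrightarrow> \<beta> p > 0"
    and "\<not> \<beta> constant_on D"
  shows "generalized_harmonic_morphism (cylinder D) (warped_metric \<beta>) D flat_metric proj_xy
    \<longleftrightarrow> (\<exists>C C1 C2. C > 0 \<and>
          ((\<forall>p\<in>D. \<beta> p = C * (p $ 1 + C1 * p $ 2 + C2) powi (-2)) \<or>
           (\<forall>p\<in>D. \<beta> p = C * (C1 * p $ 1 + p $ 2 + C2) powi (-2))))"
    (is "?L \<longleftrightarrow> ?R")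
proof
  assume ?L
  then obtain a b c where \<beta>: "\<And>q. q \<in> D \<Longrightarrow> \<beta> q = (a * q $ 1 + b * q $ 2 + c) powi (-2)"
    using affine_if_generalized_harmonic_morphism[OF assms] by blast
  have "a \<noteq> 0 \<or> b \<noteq> 0" using assms(5) \<beta> unfolding constant_on_def by auto
  then show ?R
  proof
    assume a: "a \<noteq> 0"
    have "\<beta> p = a powi (-2) * (p $ 1 + b / a * p $ 2 + c / a) powi (-2)" if "p \<in> D" for p
      unfolding \<beta>[OF that] power_int_mult_distrib[symmetric] using a by (simp add: distrib_left)
    moreover have "a powi (-2) > 0" using a by (simp add: power_int_minus)
    ultimately show ?R by blast
  next
    assume b: "b \<noteq> 0"
    have "\<beta> p = b powi (-2) * (a / b * p $ 1 + p $ 2 + c / b) powi (-2)" if "p \<in> D" for p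
      unfolding \<beta>[OF that] power_int_mult_distrib[symmetric] using b by (simp add: distrib_left)
    moreover have "b powi (-2) > 0" using b by (simp add: power_int_minus)
    ultimately show ?R by blast
  qed
next
  assume ?R
  then obtain C a b c where C: "C > 0"
    and \<beta>: "\<And>p. p \<in> D \<Longrightarrow> \<beta> p = C * (a * p $ 1 + b * p $ 2 + c) powi (-2)"
    by (metis mult_1)
  \<comment> \<open>Absorb \<open>C\<close> into the affine function.  It has no zero on \<open>D\<close>, because \<open>0 powi (-2) = 0\<close> while
    \<open>\<beta>\<close> is positive.\<close>
  define r where "r = inverse (sqrt C)"
  have "r powi (-2) = C" using C by (simp add: r_def power_int_minus power_inverse)
  then have "\<beta> p = (r * a * p $ 1 + r * b * p $ 2 + r * c) powi (-2)" if "p \<in> D" for p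
    using \<beta>[OF that] power_int_mult_distrib[of r "a * p $ 1 + b * p $ 2 + c" "-2"]
    by (simp add: algebra_simps)
  moreover from this have "r * a * p $ 1 + r * b * p $ 2 + r * c \<noteq> 0" if "p \<in> D" for p
    using assms(4)[OF that] that by fastforce
  ultimately show ?L
    using generalized_harmonic_morphism_if_affine[OF assms(1), of "r * a" "r * b" "r * c" \<beta>] by blast
qed

end
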